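(* Let $G$ be a connected graph on $n$ vertices without isolated vertices and with domination number $\gamma(G)=1$. Then for every permutation $\pi$ of $V(G)$ and every $p\in(0,1]$, $$\gamma_p(\pi G)=\begin{cases}1, & \text{if } p\in\left(0,\frac{n+1}{2n}\right],\\ 2, & \text{if } p\in\left(\frac{n+1}{2n},1\right].\end{cases}$$
   Context: All graphs are finite, simple and undirected. For a graph $H$ and $S\subseteq V(H)$, $N[S]=N_H[S]$ denotes the closed neighborhood of $S$, i.e. $S$ together with all vertices adjacent to some vertex of $S$. The domination number $\gamma(H)$ is the minimum cardinality of a set $S\subseteq V(H)$ with $N[S]=V(H)$. For $p\in(0,1]$, a set $S\subseteq V(H)$ is a $p$-dominating set of $H$ if $|N[S]|/|V(H)|\ge p$; the $p$-domination number $\gamma_p(H)$ is the minimum cardinality of a $p$-dominating set of $H$. For a permutation $\pi$ of $V(G)$, the prism $\pi G$ is the graph on $2|V(G)|$ vertices obtained from two disjoint copies $G_1$ and $G_2$ of $G$ by joining, for each $v\in V(G)$, the copy of $v$ in $G_1$ to the copy of $\pi(v)$ in $G_2$ by an edge. *)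

theory Defs
  imports
    Complex_Main
    "HOL-Combinatorics.Permutations"
    "Graph_Theory.Graph_Theory"
begin

text \<open>
  A finite simple undirected graph is a \<open>pair_graph\<close>: a finite vertex set together with a
  symmetric, irreflexive arc relation, each edge \<open>uv\<close> being represented by the two
  arcs \<open>(u, v)\<close> and \<open>(v, u)\<close>.
\<close>

definition closed_nbhd :: "'a pair_pre_digraph \<Rightarrow> 'a set \<Rightarrow> 'a set" where
  "closed_nbhd H S = S \<union> {v. \<exists>u\<in>S. (u, v) \<in> parcs H}"

definition isolated_vertex :: "'a pair_pre_digraph \<Rightarrow> 'a \<Rightarrow> bool" where
  "isolated_vertex H v \<longleftrightarrow> v \<in> pverts H \<and> (\<forall>u. (v, u) \<notin> parcs H)"

definition dominating_set :: "'a pair_pre_digraph \<Rightarrow> 'a set \<Rightarrow> bool" where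
  "dominating_set H S \<longleftrightarrow> S \<subseteq> pverts H \<and> closed_nbhd H S = pverts H"

definition domination_number :: "'a pair_pre_digraph \<Rightarrow> nat" where
  "domination_number H = Min (card ` {S. dominating_set H S})"

definition p_dominating_set :: "real \<Rightarrow> 'a pair_pre_digraph \<Rightarrow> 'a set \<Rightarrow> bool" where
  "p_dominating_set p H S \<longleftrightarrow>
     S \<subseteq> pverts H \<and> real (card (closed_nbhd H S)) / real (card (pverts H)) \<ge> p"

definition p_domination_number :: "real \<Rightarrow> 'a pair_pre_digraph \<Rightarrow> nat" where
  "p_domination_number p H = Min (card ` {S. p_dominating_set p H S})"

text \<open>
  In the prism, \<open>Inl v\<close> is the copy of \<open>v\<close> in the first copy of \<open>G\<close> and
  \<open>Inr v\<close> is its copy in the second one.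
\<close>

definition prism :: "('a \<Rightarrow> 'a) \<Rightarrow> 'a pair_pre_digraph \<Rightarrow> ('a + 'a) pair_pre_digraph" where
  "prism \<pi> G = \<lparr>
     pverts = pverts G <+> pverts G,
     parcs =
         {(Inl u, Inl v) | u v. (u, v) \<in> parcs G}
       \<union> {(Inr u, Inr v) | u v. (u, v) \<in> parcs G}
       \<union> {(Inl v, Inr (\<pi> v)) | v. v \<in> pverts G}
       \<union> {(Inr (\<pi> v), Inl v) | v. v \<in> pverts G} \<rparr>"

text \<open>
  The sets whose minimum is taken above are finite and nonempty, so \<open>Min\<close> is the genuine minimum.
  For \<open>p_domination_number\<close> this needs \<open>p \<le> 1\<close> and a nonempty vertex set.
\<close>

lemma dominating_sets_finite_nonempty:
  assumes "pair_graph G"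
  shows "finite {S. dominating_set G S}" and "{S. dominating_set G S} \<noteq> {}"
proof -
  interpret pair_graph G by fact
  have "{S. dominating_set G S} \<subseteq> Pow (pverts G)"
    by (auto simp: dominating_set_def)
  then show "finite {S. dominating_set G S}"
    by (rule finite_subset) (simp add: pair_finite_verts)
  have "dominating_set G (pverts G)"
    by (auto simp: dominating_set_def closed_nbhd_def dest: in_arcsD2)
  then show "{S. dominating_set G S} \<noteq> {}" by blast
qed

lemma p_dominating_sets_finite_nonempty:
  assumes "pair_graph G" and "pverts G \<noteq> {}" and "p \<le> 1"
  shows "finite {S. p_dominating_set p G S}" and "{S. p_dominating_set p G S} \<noteq> {}"
proof -
  interpret pair_graph G by fact
  have "{S. p_dominating_set p G S} \<subseteq> Pow (pverts G)"
    by (auto simp: p_dominating_set_def)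
  then show "finite {S. p_dominating_set p G S}"
    by (rule finite_subset) (simp add: pair_finite_verts)
  have "closed_nbhd G (pverts G) = pverts G"
    by (auto simp: closed_nbhd_def dest: in_arcsD2)
  then have "p_dominating_set p G (pverts G)"
    using assms(2,3) pair_finite_verts by (simp add: p_dominating_set_def)
  then show "{S. p_dominating_set p G S} \<noteq> {}" by blast
qed

lemma card_pverts_prism:
  assumes "pair_graph G"
  shows "card (pverts (prism \<pi> G)) = 2 * card (pverts G)"
proof -
  interpret pair_graph G by fact
  show ?thesis by (simp add: prism_def card_Plus pair_finite_verts)
qed

lemma pair_graph_prism:
  assumes "pair_graph G" and "\<pi> permutes pverts G"
  shows "pair_graph (prism \<pi> G)"
proof -
  interpret pair_graph G by fact
  have img: "\<pi> v \<in> pverts G" if "v \<in> pverts G" for v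
    using that assms(2) by (simp add: permutes_in_image)
  have fin: "finite (pverts (prism \<pi> G))"
    by (simp add: prism_def pair_finite_verts)
  have sub: "parcs (prism \<pi> G) \<subseteq> pverts (prism \<pi> G) \<times> pverts (prism \<pi> G)"
    by (auto simp: prism_def img dest: in_arcsD1 in_arcsD2)
  have symG: "(v, u) \<in> parcs G" if "(u, v) \<in> parcs G" for u v
    using pair_sym_arcs that by (auto simp: symmetric_def sym_def)
  show ?thesis
  proof
    show "finite (pverts (prism \<pi> G))" by fact
    show "finite (parcs (prism \<pi> G))"
      using sub fin by (meson finite_SigmaI finite_subset)
    show "symmetric (with_proj (prism \<pi> G))"
      unfolding symmetric_def by (auto simp: prism_def sym_def symG)
    show "fst e \<in> pverts (prism \<pi> G)" "snd e \<in> pverts (prism \<pi> G)"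
      if "e \<in> parcs (prism \<pi> G)" for e
      using sub that by auto
    show "fst e \<noteq> snd e" if "e \<in> parcs (prism \<pi> G)" for e
      using that by (auto simp: prism_def dest: no_loops')
  qed
qed

end

theory Submission
  imports Defs
begin

text \<open>
  Write \<open>V\<close> for the vertex set of \<open>G\<close>. The prism has \<open>2n\<close> vertices, and each of them has
  exactly one neighbour in the opposite copy of \<open>G\<close>, because \<open>\<pi>\<close> is a bijection. Hence one
  vertex dominates at most \<open>n + 1\<close> vertices (\<open>card_closed_nbhd_prism_singleton_le\<close>).
  Since \<open>\<gamma>(G) = 1\<close>, some vertex \<open>u\<close> is adjacent to all others, and its copies are as efficient
  as possible: either copy of \<open>u\<close> attains the bound \<open>n + 1\<close>, and the two together dominate
  everything. So one vertex suffices precisely for \<open>p \<le> (n + 1) / (2n)\<close>, and two always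
  suffice; the empty set never does, as \<open>p > 0\<close>.
\<close>

lemma p_domination_number_eqI:
  assumes "finite (pverts H)" and "p_dominating_set p H S" and "card S = k"
    and "\<And>T. p_dominating_set p H T \<Longrightarrow> k \<le> card T"
  shows "p_domination_number p H = k"
proof -
  have "{T. p_dominating_set p H T} \<subseteq> Pow (pverts H)"
    by (auto simp: p_dominating_set_def)
  then have "finite {T. p_dominating_set p H T}"
    using assms(1) by (simp add: finite_subset)
  then show ?thesis
    unfolding p_domination_number_def using assms(2-4) by (intro Min_eqI) auto
qed

lemma p_dominating_set_card_pos:
  assumes "finite (pverts H)" and "p > 0" and "p_dominating_set p H S"
  shows "1 \<le> card S"
proof -
  have "S \<noteq> {}"
    using assms(2,3) by (auto simp: p_dominating_set_def closed_nbhd_def)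
  moreover have "finite S"
    using assms(1,3) by (auto simp: p_dominating_set_def intro: finite_subset)
  ultimately show ?thesis by (simp add: Suc_le_eq card_gt_0_iff)
qed

lemma domination_number_1_obtains_universal_vertex:
  assumes "pair_graph G" and "domination_number G = 1"
  obtains u where "u \<in> pverts G" and "closed_nbhd G {u} = pverts G"
proof -
  have "domination_number G \<in> card ` {S. dominating_set G S}"
    unfolding domination_number_def
    using dominating_sets_finite_nonempty[OF assms(1)] by (intro Min_in) auto
  then obtain S where S: "dominating_set G S" "card S = 1"
    using assms(2) by auto
  from S(2) obtain u where "S = {u}" by (auto simp: card_1_singleton_iff)
  with S(1) show thesis by (intro that[of u]) (auto simp: dominating_set_def)
qed

lemma closed_nbhd_prism_Inl:
  assumes "v \<in> pverts G"
  shows "closed_nbhd (prism \<pi> G) {Inl v} = insert (Inr (\<pi> v)) (Inl ` closed_nbhd G {v})"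
  using assms by (auto simp: closed_nbhd_def prism_def)

text \<open>
  Indexing the second copy by \<open>\<pi> v\<close> instead of \<open>v\<close> names the opposite neighbour without
  mentioning the inverse permutation; surjectivity of \<open>\<pi>\<close> makes this cover every vertex of the
  second copy, and injectivity makes \<open>Inl v\<close> the only opposite neighbour.
\<close>

lemma closed_nbhd_prism_Inr:
  assumes "\<pi> permutes pverts G" and "v \<in> pverts G"
  shows "closed_nbhd (prism \<pi> G) {Inr (\<pi> v)} = insert (Inl v) (Inr ` closed_nbhd G {\<pi> v})"
  using assms(2) permutes_inj[OF assms(1)]
  by (auto simp: closed_nbhd_def prism_def inj_eq)

lemma finite_card_closed_nbhd_singleton:
  assumes "pair_graph G" and "v \<in> pverts G"
  shows "finite (closed_nbhd G {v})" and "card (closed_nbhd G {v}) \<le> card (pverts G)"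
proof -
  interpret pair_graph G by fact
  have "closed_nbhd G {v} \<subseteq> pverts G"
    using assms(2) by (auto simp: closed_nbhd_def dest: in_arcsD2)
  then show "finite (closed_nbhd G {v})" and "card (closed_nbhd G {v}) \<le> card (pverts G)"
    using pair_finite_verts by (auto intro: finite_subset card_mono)
qed

lemma card_closed_nbhd_prism_singleton_le:
  assumes "pair_graph G" and "\<pi> permutes pverts G" and "x \<in> pverts (prism \<pi> G)"
  shows "card (closed_nbhd (prism \<pi> G) {x}) \<le> card (pverts G) + 1"
proof -
  \<comment> \<open>Inserting the opposite neighbour into a copy of \<open>N[v]\<close> adds at most one vertex.\<close>
  have bound: "card (insert y (f ` closed_nbhd G {v})) \<le> card (pverts G) + 1"
    if "v \<in> pverts G" for y :: "'a + 'a" and f v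
  proof -
    have "card (f ` closed_nbhd G {v}) \<le> card (pverts G)"
      using finite_card_closed_nbhd_singleton[OF assms(1) that] card_image_le le_trans by blast
    then show ?thesis
      using card_insert_le_m1[of "card (pverts G) + 1"] by simp
  qed
  from assms(3) consider v where "v \<in> pverts G" "x = Inl v"
    | w where "w \<in> pverts G" "x = Inr w"
    by (auto simp: prism_def)
  then show ?thesis
  proof cases
    case 1
    then show ?thesis using bound by (simp add: closed_nbhd_prism_Inl)
  next
    case 2
    then obtain v where "v \<in> pverts G" "w = \<pi> v"
      using permutes_image[OF assms(2)] by blast
    with 2 show ?thesis
      using bound by (simp add: closed_nbhd_prism_Inr[OF assms(2)])
  qed
qed

lemma card_closed_nbhd_prism_universal_vertex:
  assumes "pair_graph G" and "u \<in> pverts G" and "closed_nbhd G {u} = pverts G"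
  shows "card (closed_nbhd (prism \<pi> G) {Inl u}) = card (pverts G) + 1"
proof -
  interpret pair_graph G by fact
  have "Inr (\<pi> u) \<notin> Inl ` pverts G" by auto
  then show ?thesis
    using assms(2,3) pair_finite_verts
    by (simp add: closed_nbhd_prism_Inl card_image)
qed

lemma closed_nbhd_prism_universal_pair:
  assumes "pair_graph G" and "\<pi> permutes pverts G"
    and "u \<in> pverts G" and "closed_nbhd G {u} = pverts G"
  shows "closed_nbhd (prism \<pi> G) {Inl u, Inr u} = pverts (prism \<pi> G)"
proof -
  obtain v where v: "v \<in> pverts G" "u = \<pi> v"
    using permutes_image[OF assms(2)] assms(3) by blast
  have "closed_nbhd (prism \<pi> G) {Inl u, Inr u} =
      closed_nbhd (prism \<pi> G) {Inl u} \<union> closed_nbhd (prism \<pi> G) {Inr u}"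
    by (auto simp: closed_nbhd_def)
  also have "closed_nbhd (prism \<pi> G) {Inl u} = insert (Inr (\<pi> u)) (Inl ` pverts G)"
    using assms(3,4) by (simp add: closed_nbhd_prism_Inl)
  also have "closed_nbhd (prism \<pi> G) {Inr u} = insert (Inl v) (Inr ` pverts G)"
    using closed_nbhd_prism_Inr[OF assms(2) v(1)] assms(4) v(2) by simp
  finally show ?thesis
    using v(1) permutes_in_image[OF assms(2), of u] assms(3) by (auto simp: prism_def)
qed

theorem proposition3p1:
  fixes G :: "'a pair_pre_digraph" and \<pi> :: "'a \<Rightarrow> 'a" and n :: nat and p :: real
  assumes "pair_graph G"
    and "connected (with_proj G)"
    and "n = card (pverts G)"
    and "\<not> (\<exists>v. isolated_vertex G v)"
    and "domination_number G = 1"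
    and "\<pi> permutes pverts G"
    and "p \<in> {0<..1}"
  shows "(p \<in> {0<..(real n + 1) / (2 * real n)} \<longrightarrow> p_domination_number p (prism \<pi> G) = 1) \<and>
         (p \<in> {(real n + 1) / (2 * real n)<..1} \<longrightarrow> p_domination_number p (prism \<pi> G) = 2)"
proof -
  interpret pair_graph G by fact
  let ?P = "prism \<pi> G"
  obtain u where u: "u \<in> pverts G" "closed_nbhd G {u} = pverts G"
    using domination_number_1_obtains_universal_vertex assms(1,5) by blast
  have finP: "finite (pverts ?P)"
    by (simp add: prism_def pair_finite_verts)
  have uP: "Inl u \<in> pverts ?P" "Inr u \<in> pverts ?P"
    using u(1) by (auto simp: prism_def)
  have cardP: "card (pverts ?P) = 2 * n"
    using card_pverts_prism assms(1,3) by blast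
  have card_pos: "1 \<le> card T" if "p_dominating_set p ?P T" for T
    using p_dominating_set_card_pos[OF finP _ that] assms(7) by simp
  show ?thesis
  proof (intro conjI impI)
    assume "p \<in> {0<..(real n + 1) / (2 * real n)}"
    then have "p_dominating_set p ?P {Inl u}"
      using card_closed_nbhd_prism_universal_vertex[OF assms(1) u, of \<pi>] uP assms(3) cardP
      by (simp add: p_dominating_set_def add.commute)
    then show "p_domination_number p ?P = 1"
      using card_pos by (intro p_domination_number_eqI[OF finP]) auto
  next
    assume p: "p \<in> {(real n + 1) / (2 * real n)<..1}"
    have "card (pverts ?P) > 0"
      using finP uP by (auto simp: card_gt_0_iff)
    then have dom: "p_dominating_set p ?P {Inl u, Inr u}"
      using closed_nbhd_prism_universal_pair[OF assms(1,6) u] uP p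
      by (simp add: p_dominating_set_def)
    have "card T \<noteq> 1" if T: "p_dominating_set p ?P T" for T
    proof
      assume "card T = 1"
      then obtain x where x: "T = {x}" by (auto simp: card_1_singleton_iff)
      with T have "x \<in> pverts ?P" by (simp add: p_dominating_set_def)
      then have "real (card (closed_nbhd ?P T)) \<le> real n + 1"
        using card_closed_nbhd_prism_singleton_le[OF assms(1,6)] x assms(3) by force
      then have "real (card (closed_nbhd ?P T)) / (2 * real n) \<le> (real n + 1) / (2 * real n)"
        by (intro divide_right_mono) auto
      with T p cardP show False by (simp add: p_dominating_set_def)
    qed
    with card_pos have "2 \<le> card T" if "p_dominating_set p ?P T" for T
      using that by (metis One_nat_def Suc_1 Suc_leI le_neq_implies_less)
    then show "p_domination_number p ?P = 2"
      using dom by (intro p_domination_number_eqI[OF finP]) auto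
  qed
qed

end
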